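(* For almost every real number $\alpha>3$ (with respect to one-dimensional Lebesgue measure), the equation $x+y=z$ has at most finitely many solutions $(x,y,z)\in \mathrm{PS}(\alpha)^3$.
   Context: For real $\alpha>1$, $\mathrm{PS}(\alpha)=\{\lfloor n^\alpha\rfloor : n\in\mathbb{N}\}$, where $\mathbb{N}$ is the set of positive integers and $\lfloor x\rfloor$ is the integer part of $x$. *)

theory Defs
  imports "HOL-Analysis.Analysis"
begin

definition PS :: "real \<Rightarrow> int set" where
  "PS \<alpha> = {\<lfloor>real n powr \<alpha>\<rfloor> | n :: nat. 0 < n}"

end

theory Submission
  imports Defs
begin

text \<open>
  A solution with indices \<open>l \<le> m < n\<close> forces \<open>\<bar>l\<^sup>\<alpha> + m\<^sup>\<alpha> - n\<^sup>\<alpha>\<bar> < 2\<close>, so the decreasing function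
  \<open>\<alpha> \<mapsto> (l/n)\<^sup>\<alpha> + (m/n)\<^sup>\<alpha>\<close> is within \<open>2 n\<^sup>-\<^sup>\<alpha>\<close> of \<open>1\<close>. There \<open>(m/n)\<^sup>\<alpha>\<close> is bounded below, hence the
  slope is at least of order \<open>(n - m)/n\<close>, and the exponents \<open>\<alpha> \<ge> a\<close> in question lie in an interval of
  length \<open>O(n\<^bsup>1-a\<^esup>/(n - m))\<close>. Summing over \<open>l\<close> and \<open>m\<close> gives \<open>O(n\<^bsup>2-a\<^esup> log n)\<close>, which is summable
  over \<open>n\<close> when \<open>a > 3\<close>, and the Borel--Cantelli lemma applies.
\<close>

section \<open>Exponents nearly solving the equation for fixed indices\<close>

definition near_solutions :: "nat \<Rightarrow> nat \<Rightarrow> nat \<Rightarrow> real set" where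
  "near_solutions l m n = {\<alpha>. \<bar>real l powr \<alpha> + real m powr \<alpha> - real n powr \<alpha>\<bar> < 2}"

lemma near_solutions_commute: "near_solutions l m n = near_solutions m l n"
  by (simp add: near_solutions_def add.commute)

text \<open>The real expression is a sum of two fractional parts minus a third, hence lies strictly
  between -1 and 2.\<close>

lemma near_solutions_of_floor_eq:
  assumes "\<lfloor>real l powr \<alpha>\<rfloor> + \<lfloor>real m powr \<alpha>\<rfloor> = \<lfloor>real n powr \<alpha>\<rfloor>"
  shows "\<alpha> \<in> near_solutions l m n"
  using assms unfolding near_solutions_def by simp linarith

text \<open>With \<open>q powr \<beta>\<close> factored out, what remains is
  \<open>exp t - 1 \<ge> t\<close> for \<open>t = (\<beta> - \<alpha>) * - ln q\<close>, and
  \<open>- ln q \<ge> 1 - q\<close>.\<close>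

lemma powr_diff_lower_bound:
  fixes q :: real
  assumes "0 < q" "\<alpha> \<le> \<beta>"
  shows "q powr \<beta> * ((\<beta> - \<alpha>) * (1 - q)) \<le> q powr \<alpha> - q powr \<beta>"
proof -
  have "1 - q \<le> - ln q"
    using ln_le_minus_one[OF assms(1)] by simp
  then have "(\<beta> - \<alpha>) * (1 - q) \<le> (\<beta> - \<alpha>) * - ln q"
    using assms by (intro mult_left_mono) auto
  also have "\<dots> \<le> exp ((\<alpha> - \<beta>) * ln q) - 1"
    using exp_ge_add_one_self[of "(\<alpha> - \<beta>) * ln q"] by (simp add: algebra_simps)
  also have "\<dots> = q powr (\<alpha> - \<beta>) - 1"
    using assms by (simp add: powr_def)
  finally have "q powr \<beta> * ((\<beta> - \<alpha>) * (1 - q)) \<le> q powr \<beta> * (q powr (\<alpha> - \<beta>) - 1)"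
    by (intro mult_left_mono) auto
  also have "\<dots> = q powr \<alpha> - q powr \<beta>"
    by (simp add: right_diff_distrib flip: powr_add)
  finally show ?thesis .
qed

lemma near_solutions_scaled:
  assumes "\<alpha> \<in> near_solutions l m n" "a \<le> \<alpha>" "0 < n"
  shows "\<bar>(l / n) powr \<alpha> + (m / n) powr \<alpha> - 1\<bar> \<le> 2 * real n powr - a"
proof -
  have pos: "real n powr \<alpha> > 0"
    using assms by simp
  have "(l / n) powr \<alpha> + (m / n) powr \<alpha> - 1
      = (real l powr \<alpha> + real m powr \<alpha> - real n powr \<alpha>) / real n powr \<alpha>"
    using pos by (simp add: powr_divide field_simps)
  then have "\<bar>(l / n) powr \<alpha> + (m / n) powr \<alpha> - 1\<bar> \<le> 2 / real n powr \<alpha>"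
    using assms(1) pos by (simp add: near_solutions_def divide_right_mono)
  also have "\<dots> = 2 * real n powr - \<alpha>"
    by (simp add: powr_minus divide_inverse)
  also have "\<dots> \<le> 2 * real n powr - a"
    using assms by (intro mult_left_mono powr_mono) auto
  finally show ?thesis .
qed

lemma near_solutions_diff_le:
  assumes near: "\<alpha> \<in> near_solutions l m n" "\<beta> \<in> near_solutions l m n"
    and "a \<le> \<alpha>" "\<alpha> \<le> \<beta>" "3 \<le> a" "0 < l" "l \<le> m" "m < n"
  shows "\<beta> - \<alpha> \<le> 11 * real n powr (1 - a) / real (n - m)"
proof -
  let ?N = "real n powr - a"
  have n2: "2 \<le> real n"
    using assms by linarith
  \<comment> \<open>This makes the error \<open>2 * ?N\<close> at most 1/4, so the two scaled powers
    sum to at least 3/4.\<close>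
  have "?N \<le> real n powr - 3"
    using assms n2 by (intro powr_mono) auto
  also have "\<dots> \<le> 2 powr - 3"
    using n2 by (intro powr_mono2') auto
  also have "\<dots> = 1 / 8"
    by (simp add: powr_minus powr_numeral)
  finally have N: "?N \<le> 1 / 8" .
  have \<alpha>: "\<bar>(l / n) powr \<alpha> + (m / n) powr \<alpha> - 1\<bar> \<le> 2 * ?N"
    and \<beta>: "\<bar>(l / n) powr \<beta> + (m / n) powr \<beta> - 1\<bar> \<le> 2 * ?N"
    using assms by (intro near_solutions_scaled; simp)+
  have "(l / n) powr \<beta> \<le> (m / n) powr \<beta>"
    using assms by (intro powr_mono2) (auto simp: divide_right_mono)
  \<comment> \<open>The larger of the two powers is at least half of 3/4.\<close>
  then have q: "3 / 8 \<le> (m / n) powr \<beta>"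
    using \<beta> N by linarith
  have l: "(l / n) powr \<beta> \<le> (l / n) powr \<alpha>"
    using assms by (intro powr_mono') auto
  have eq: "1 - m / n = real (n - m) / n"
    using assms by (simp add: field_simps of_nat_diff)
  have "3 / 8 * ((\<beta> - \<alpha>) * (1 - m / n)) \<le> (m / n) powr \<beta> * ((\<beta> - \<alpha>) * (1 - m / n))"
    using q assms by (intro mult_right_mono mult_nonneg_nonneg) auto
  also have "\<dots> \<le> (m / n) powr \<alpha> - (m / n) powr \<beta>"
    using assms by (intro powr_diff_lower_bound) auto
  \<comment> \<open>Both sums are within \<open>2 * ?N\<close> of 1, and the power of
    \<open>l / n\<close> does not grow from \<alpha> to \<beta>, so the power of
    \<open>m / n\<close> drops by at most \<open>4 * ?N\<close>.\<close>
  also have "\<dots> \<le> 4 * ?N"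
    using \<alpha> \<beta> l by linarith
  finally have "(\<beta> - \<alpha>) * (real (n - m) / n) \<le> 32 / 3 * ?N"
    unfolding eq by linarith
  \<comment> \<open>Here 32/3 is 4 divided by 3/8; 11 is the next integer.\<close>
  also have "\<dots> \<le> 11 * ?N"
    by (intro mult_right_mono) auto
  finally have "(\<beta> - \<alpha>) * real (n - m) \<le> 11 * (n * ?N)"
    using n2 by (simp add: field_simps)
  also have "real n * ?N = real n powr (1 - a)"
    using n2 by (simp add: powr_diff powr_minus divide_inverse)
  finally show ?thesis
    using assms by (simp add: field_simps)
qed

lemma near_solutions_cover:
  assumes "3 \<le> a" "0 < l" "l \<le> m" "m < n"
  obtains c where "near_solutions l m n \<inter> {a..}
    \<subseteq> {c - 11 * real n powr (1 - a) / real (n - m) .. c + 11 * real n powr (1 - a) / real (n - m)}"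
proof (cases "near_solutions l m n \<inter> {a..} = {}")
  case False
  \<comment> \<open>Any point of the set serves as centre: the bound on the diameter becomes a
    radius, at the cost of a factor 2 in length.\<close>
  then obtain c where c: "c \<in> near_solutions l m n" "a \<le> c"
    by auto
  have "\<bar>x - c\<bar> \<le> 11 * real n powr (1 - a) / real (n - m)"
    if "x \<in> near_solutions l m n" "a \<le> x" for x
    using near_solutions_diff_le[of x l m n c a] near_solutions_diff_le[of c l m n x a] c that assms
    by (cases "x \<le> c") auto
  then show thesis
    by (intro that[of c]) (force simp: abs_le_iff)
qed (use that in auto)

section \<open>Harmonic numbers and summability\<close>

lemma harm_le_one_plus_ln:
  assumes "0 < n"
  shows "harm n \<le> 1 + ln (real n)"
proof -
  have "harm (Suc (n - 1)) - ln (Suc (n - 1)) \<le> harm (Suc 0) - ln (Suc 0)"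
    using decseq_harm_diff_ln by (rule decseqD) simp
  then show ?thesis
    using assms by (simp add: harm_expand)
qed

lemma sum_inverse_diff_eq_harm: "(\<Sum>m<n. 1 / real (n - m)) = harm n"
proof -
  have "(\<Sum>m<n. 1 / real (n - m)) = (\<Sum>m<n. inverse (real (Suc (n - Suc m))))"
    by (intro sum.cong) (auto simp: Suc_diff_Suc divide_inverse)
  also have "\<dots> = harm n"
    unfolding harm_altdef by (rule sum.nat_diff_reindex)
  finally show ?thesis .
qed

lemma summable_powr_mult_harm:
  assumes "s < -1"
  shows "summable (\<lambda>n. real n powr s * harm n)"
proof -
  \<comment> \<open>Half the gap between \<open>s\<close> and -1: the logarithm is absorbed by
    \<open>n powr e\<close>, while \<open>s + e\<close> stays below -1.\<close>
  define e where "e = (-1 - s) / 2"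
  have e: "e > 0" "s + e < -1"
    using assms by (auto simp: e_def field_simps)
  show ?thesis
  proof (rule summable_comparison_test'[where N = 1])
    show "summable (\<lambda>n. (1 + 1 / e) * real n powr (s + e))"
      using e by (intro summable_mult) (simp add: summable_real_powr_iff)
    fix n :: nat
    assume n: "1 \<le> n"
    have "harm n \<le> 1 + ln (real n)"
      using n by (intro harm_le_one_plus_ln) simp
    also have "\<dots> \<le> real n powr e + real n powr e / e"
      using n e by (intro add_mono ln_powr_bound ge_one_powr_ge_zero) auto
    finally have "real n powr s * harm n \<le> real n powr s * ((1 + 1 / e) * real n powr e)"
      by (intro mult_left_mono) (auto simp: field_simps)
    then show "norm (real n powr s * harm n) \<le> (1 + 1 / e) * real n powr (s + e)"
      by (simp add: powr_add mult_ac harm_nonneg abs_mult)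
  qed
qed

section \<open>Borel-Cantelli for a fixed lower bound on the exponent\<close>

lemma AE_eventually_no_near_solution:
  assumes a: "3 < a"
  shows "AE \<alpha> in lborel. a \<le> \<alpha> \<longrightarrow>
    (\<forall>\<^sub>F n in sequentially. \<forall>m<n. \<forall>l\<in>{0<..m}. \<alpha> \<notin> near_solutions l m n)"
proof -
  define D where "D n m = 11 * real n powr (1 - a) / real (n - m)" for n m
  have "\<exists>c. near_solutions l m n \<inter> {a..} \<subseteq> {c - D n m .. c + D n m}"
    if "0 < l" "l \<le> m" "m < n" for l m n
    using near_solutions_cover[of a l m n] a that unfolding D_def by force
  then obtain c where c: "\<And>l m n. 0 < l \<Longrightarrow> l \<le> m \<Longrightarrow> m < n \<Longrightarrow>
      near_solutions l m n \<inter> {a..} \<subseteq> {c l m n - D n m .. c l m n + D n m}"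
    by metis
  \<comment> \<open>Finite unions of the covering intervals replace the sets of near solutions, so
    that measurability and finite measure are immediate.\<close>
  define A where "A n = (\<Union>m<n. \<Union>l\<in>{0<..m}. {c l m n - D n m .. c l m n + D n m})" for n
  have D_nonneg: "D n m \<ge> 0" for n m
    by (simp add: D_def)
  have A_sets: "A n \<in> sets lborel" for n
    unfolding A_def by auto
  have A_fin: "emeasure lborel (A n) < \<infinity>" for n
  proof -
    have "bounded (A n)"
      unfolding A_def by (intro bounded_UN ballI) auto
    then show ?thesis
      by (rule emeasure_bounded_finite)
  qed
  have A_le: "measure lborel (A n) \<le> 22 * (real n powr (2 - a) * harm n)" for n
  proof -
    have fm: "{x - D n m .. x + D n m} \<in> fmeasurable lborel" for x m
      by (intro fmeasurableI) (auto simp: emeasure_lborel_Icc_eq)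
    have inner: "measure lborel (\<Union>l\<in>{0<..m}. {c l m n - D n m .. c l m n + D n m})
        \<le> real n * (2 * D n m)" if "m < n" for m
    proof -
      have "measure lborel (\<Union>l\<in>{0<..m}. {c l m n - D n m .. c l m n + D n m})
          \<le> (\<Sum>l\<in>{0<..m}. measure lborel {c l m n - D n m .. c l m n + D n m})"
        using fm by (intro measure_UNION_le) auto
      also have "\<dots> = real m * (2 * D n m)"
        using D_nonneg[of n m] by simp
      also have "\<dots> \<le> real n * (2 * D n m)"
        using that D_nonneg[of n m] by (intro mult_right_mono) auto
      finally show ?thesis .
    qed
    have "measure lborel (A n)
        \<le> (\<Sum>m<n. measure lborel (\<Union>l\<in>{0<..m}. {c l m n - D n m .. c l m n + D n m}))"
      unfolding A_def using fm by (intro measure_UNION_le) auto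
    also have "\<dots> \<le> (\<Sum>m<n. real n * (2 * D n m))"
      using inner by (intro sum_mono) auto
    \<comment> \<open>The factor \<open>n\<close> bounds the number of choices of \<open>l\<close>;
      the sum over \<open>m\<close> of the reciprocal gaps is harmonic.\<close>
    also have "\<dots> = 22 * (real n * real n powr (1 - a)) * (\<Sum>m<n. 1 / real (n - m))"
      unfolding D_def sum_distrib_left by (intro sum.cong) auto
    also have "\<dots> = 22 * (real n powr (2 - a) * harm n)"
      unfolding sum_inverse_diff_eq_harm
      by (cases "n = 0") (auto simp: powr_diff power2_eq_square powr_numeral)
    finally show ?thesis .
  qed
  have "summable (\<lambda>n. 22 * (real n powr (2 - a) * harm n))"
    \<comment> \<open>Since \<open>a > 3\<close>, the exponent \<open>2 - a\<close> is below
      -1.\<close>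
    using a by (intro summable_mult summable_powr_mult_harm) simp
  then have "summable (\<lambda>n. measure lborel (A n))"
    by (rule summable_comparison_test'[where N = 0]) (simp add: A_le)
  with A_sets A_fin
  have "AE \<alpha> in lborel. \<forall>\<^sub>F n in sequentially. \<alpha> \<in> space lborel - A n"
    by (rule borel_cantelli_AE1)
  then show ?thesis
  proof (rule AE_mp, intro AE_I2 impI)
    fix \<alpha>
    assume ev: "\<forall>\<^sub>F n in sequentially. \<alpha> \<in> space lborel - A n" and \<alpha>: "a \<le> \<alpha>"
    from ev show "\<forall>\<^sub>F n in sequentially. \<forall>m<n. \<forall>l\<in>{0<..m}. \<alpha> \<notin> near_solutions l m n"
    proof (eventually_elim, intro allI ballI impI notI)
      fix n m l
      assume "\<alpha> \<in> space lborel - A n" "m < n" "l \<in> {0<..m}" "\<alpha> \<in> near_solutions l m n"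
      with c[of l m n] \<alpha> show False
        unfolding A_def by fastforce
    qed
  qed
qed

section \<open>From near solutions to finitely many triples\<close>

lemma floor_powr_less_index:
  assumes "1 \<le> \<alpha>" "0 < l" "\<lfloor>real l powr \<alpha>\<rfloor> + \<lfloor>real m powr \<alpha>\<rfloor> = \<lfloor>real n powr \<alpha>\<rfloor>"
  shows "m < n"
proof (rule ccontr)
  assume "\<not> m < n"
  then have "real n powr \<alpha> \<le> real m powr \<alpha>"
    using assms by (intro powr_mono2) auto
  \<comment> \<open>The summand coming from \<open>l\<close> is at least 1, so the right-hand floor
    strictly exceeds the one of \<open>m\<close>, against monotonicity.\<close>
  moreover have "1 \<le> real l powr \<alpha>"
    using assms by (intro ge_one_powr_ge_zero) auto
  then have "1 \<le> \<lfloor>real l powr \<alpha>\<rfloor>"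
    by simp
  ultimately show False
    using assms(3) floor_mono[of "real n powr \<alpha>" "real m powr \<alpha>"] by linarith
qed

lemma finite_PS_solutions:
  assumes "1 \<le> \<alpha>"
    and "\<forall>\<^sub>F n in sequentially. \<forall>m<n. \<forall>l\<in>{0<..m}. \<alpha> \<notin> near_solutions l m n"
  shows "finite {(x, y, z). x \<in> PS \<alpha> \<and> y \<in> PS \<alpha> \<and> z \<in> PS \<alpha> \<and> x + y = z}"
proof -
  obtain N where N: "\<And>n m l. N \<le> n \<Longrightarrow> m < n \<Longrightarrow> l \<in> {0<..m} \<Longrightarrow> \<alpha> \<notin> near_solutions l m n"
    using assms(2) unfolding eventually_sequentially by blast
  let ?F = "(\<lambda>n. \<lfloor>real n powr \<alpha>\<rfloor>) ` {..<N}"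
  have "{(x, y, z). x \<in> PS \<alpha> \<and> y \<in> PS \<alpha> \<and> z \<in> PS \<alpha> \<and> x + y = z} \<subseteq> ?F \<times> ?F \<times> ?F"
  proof
    fix t
    assume "t \<in> {(x, y, z). x \<in> PS \<alpha> \<and> y \<in> PS \<alpha> \<and> z \<in> PS \<alpha> \<and> x + y = z}"
    then obtain x y where t: "t = (x, y, x + y)" and "x \<in> PS \<alpha>" "y \<in> PS \<alpha>" "x + y \<in> PS \<alpha>"
      by auto
    then obtain l m n where pos: "0 < l" "0 < m"
      and xy: "x = \<lfloor>real l powr \<alpha>\<rfloor>" "y = \<lfloor>real m powr \<alpha>\<rfloor>" "x + y = \<lfloor>real n powr \<alpha>\<rfloor>"
      unfolding PS_def by blast
    then have sum: "\<lfloor>real l powr \<alpha>\<rfloor> + \<lfloor>real m powr \<alpha>\<rfloor> = \<lfloor>real n powr \<alpha>\<rfloor>"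
      by simp
    have less: "m < n" "l < n"
      using floor_powr_less_index[of \<alpha> l m n] floor_powr_less_index[of \<alpha> m l n] assms(1) pos sum
      by (auto simp: add.commute)
    have "\<alpha> \<in> near_solutions l m n" "\<alpha> \<in> near_solutions m l n"
      using near_solutions_of_floor_eq[OF sum] by (simp_all add: near_solutions_commute)
    \<comment> \<open>The exclusion beyond \<open>N\<close> covers ordered indices only; symmetry in
      \<open>l\<close> and \<open>m\<close> settles the other order. As \<open>n\<close> is the
      largest index, this bounds all three.\<close>
    then have "n < N"
      using N[of n m l] N[of n l m] less pos by (cases "l \<le> m"; cases "N \<le> n") auto
    then show "t \<in> ?F \<times> ?F \<times> ?F"
      unfolding t using less xy by auto
  qed
  then show ?thesis
    by (rule finite_subset) auto
qed

theorem theorem1p2: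
  shows "AE \<alpha> in (lebesgue :: real measure). \<alpha> > 3 \<longrightarrow>
    finite {(x, y, z). x \<in> PS \<alpha> \<and> y \<in> PS \<alpha> \<and> z \<in> PS \<alpha> \<and> x + y = z}"
proof (rule AE_completion)
  \<comment> \<open>The exceptional null set depends on the threshold \<open>a > 3\<close>, so the
    thresholds run through a countable sequence decreasing to 3.\<close>
  have "AE \<alpha> in lborel. \<forall>j. 3 + inverse (real (Suc j)) \<le> \<alpha> \<longrightarrow>
    (\<forall>\<^sub>F n in sequentially. \<forall>m<n. \<forall>l\<in>{0<..m}. \<alpha> \<notin> near_solutions l m n)"
    unfolding AE_all_countable by (intro allI AE_eventually_no_near_solution) simp
  then show "AE \<alpha> in (lborel :: real measure). \<alpha> > 3 \<longrightarrow>
    finite {(x, y, z). x \<in> PS \<alpha> \<and> y \<in> PS \<alpha> \<and> z \<in> PS \<alpha> \<and> x + y = z}"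
  proof (rule AE_mp, intro AE_I2 impI)
    fix \<alpha> :: real
    assume ev: "\<forall>j. 3 + inverse (real (Suc j)) \<le> \<alpha> \<longrightarrow>
        (\<forall>\<^sub>F n in sequentially. \<forall>m<n. \<forall>l\<in>{0<..m}. \<alpha> \<notin> near_solutions l m n)"
      and \<alpha>: "\<alpha> > 3"
    obtain j where "inverse (real (Suc j)) < \<alpha> - 3"
      using reals_Archimedean[of "\<alpha> - 3"] \<alpha> by auto
    then have "3 + inverse (real (Suc j)) \<le> \<alpha>"
      by linarith
    with ev \<alpha> show "finite {(x, y, z). x \<in> PS \<alpha> \<and> y \<in> PS \<alpha> \<and> z \<in> PS \<alpha> \<and> x + y = z}"
      by (intro finite_PS_solutions) auto
  qed
qed

end
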